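(* Let $\hat{\mathbf v}$ and $\hat{\mathbf S}$ be continuously differentiable constitutive mappings for velocity and stress, and let $\hat\tau$ be a continuously differentiable constitutive mapping for the total energy. Suppose that $\hat{\mathbf v}$ is normal (condition (N) of the context), that the associated mapping $\tilde{\mathbf S}$ is elliptic (condition (E) of the context), and that, for a given $T>0$, the solvability condition (S) of the context holds. Then necessary and sufficient conditions for the dissipation inequality $$\partial_t\big[\hat\tau(\mathbf F,\mathbf p)\big]\le\hat{\mathbf S}(\mathbf F,\mathbf p)\cdot\dot{\mathbf F}+\hat{\mathbf v}(\mathbf F,\mathbf p)\cdot\dot{\mathbf p}$$ to be satisfied in all admissible smooth processes $(\mathbf F(x,t),\mathbf p(x,t))$ of the materials described by $\mathbf v=\hat{\mathbf v}(\mathbf F,\mathbf p)$ and $\mathbf S=\hat{\mathbf S}(\mathbf F,\mathbf p)$ are $$\hat{\mathbf v}(\mathbf F,\mathbf p)=\partial_{\mathbf p}\hat\tau(\mathbf F,\mathbf p),\qquad \hat{\mathbf S}(\mathbf F,\mathbf p)=\partial_{\mathbf F}\hat\tau(\mathbf F,\mathbf p).$$ Moreover, if (these conditions hold and) $\hat\tau$ is twice continuously differentiable, then $\partial_{\mathbf p}\hat{\mathbf S}=\partial_{\mathbf F}\hat{\mathbf v}$, i.e. $\partial_{p_k}\hat S_{ij}=\partial_{F_{ij}}\hat v_k$ for all $i,j,k$.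
   Context: Vectors are elements of a three-dimensional inner-product space $\mathcal V$ (identified with $\mathbb R^3$); tensors are linear maps of $\mathcal V$ into itself, identified with $3\times3$ matrices in a fixed orthonormal basis, with inner product $\mathbf A\cdot\mathbf B=\sum_{i,j}A_{ij}B_{ij}$. $(\mathbf b\otimes\mathbf a)_{ij}=b_ia_j$, $(\nabla\mathbf v)_{ij}=\partial_{x_j}v_i$, $(\mathrm{Div}\,\mathbf S)_i=\sum_j\partial_{x_j}S_{ij}$; a superposed dot is $\partial_t$. The state variables are a tensor $\mathbf F$ (deformation gradient) and a vector $\mathbf p$ (momentum). The constitutive mappings $\hat{\mathbf v}(\mathbf F,\mathbf p)$, $\hat{\mathbf S}(\mathbf F,\mathbf p)$, $\hat\tau(\mathbf F,\mathbf p)$ take vector, tensor and real values, respectively. A possible explicit dependence of the mappings on the point $x$ is left tacit; there is no explicit dependence on time. An admissible smooth process is a smooth pair $(\mathbf F(x,t),\mathbf p(x,t))$ satisfying the conservation laws $\dot{\mathbf F}=\mathrm{Div}(\mathbf v\otimes\mathbf 1)=\nabla\mathbf v$ and $\dot{\mathbf p}=\mathrm{Div}\,\mathbf S$ with $\mathbf v=\hat{\mathbf v}(\mathbf F,\mathbf p)$ and $\mathbf S=\hat{\mathbf S}(\mathbf F,\mathbf p)$. (N) Normality: for each fixed $\mathbf F$, the matrix $N_{ih}(\mathbf F,\mathbf p)=\partial_{p_h}\hat v_i(\mathbf F,\mathbf p)$ is invertible for all $\mathbf p$. This formalizes that momentum and velocity are locally in one-to-one correspondence: for each fixed $\mathbf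 F$ the map $\mathbf p\mapsto\hat{\mathbf v}(\mathbf F,\mathbf p)$ has a local inverse $\mathbf v\mapsto\hat{\mathbf p}(\mathbf F,\mathbf v)$, with $\hat{\mathbf v}(\mathbf F,\hat{\mathbf p}(\mathbf F,\mathbf v))=\mathbf v$. In terms of this inverse set $\tilde{\mathbf S}(\mathbf F,\mathbf v):=\hat{\mathbf S}(\mathbf F,\hat{\mathbf p}(\mathbf F,\mathbf v))$. (E) Ellipticity (in the sense of Petrovsky): for each fixed $\mathbf v$ and each vector $\mathbf a\neq\mathbf 0$, the matrix $E_{ih}(\mathbf F,\mathbf v;\mathbf a)=\sum_{j,k}\partial_{F_{hk}}\tilde S_{ij}(\mathbf F,\mathbf v)\,a_ja_k$ is invertible for all $\mathbf F$. (S) Solvability: for each fixed triplet $(\mathbf A,\mathbf a,\mathbf c)$ ($\mathbf A$ a tensor, $\mathbf a\neq\mathbf 0$ and $\mathbf c$ vectors), the initial-value problem $$\dot{\mathbf F}=\nabla\mathbf v,\quad \dot{\mathbf p}=\mathrm{Div}\,\tilde{\mathbf S}(\mathbf F,\mathbf v)\quad\text{on }\mathbb R^3\times(0,T),$$ $$\mathbf F(x,0)=\mathbf A+\big(\mathbf a\cdot(x-x_o)\big)\mathbf b\otimes\mathbf a,\quad \mathbf v(x,0)=\mathbf B(x-x_o)+\mathbf c,$$ with $\mathbf p=\hat{\mathbf p}(\mathbf F,\mathbf v)$, has a classical solution up to time $T$ for all choices of the tensor $\mathbf B$, the vector $\mathbf b$ and the point $x_o\in\mathbb R^3$. *)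

theory Defs
  imports "HOL-Analysis.Analysis"
begin

type_synonym vec3 = "real^3"
type_synonym tensor = "real^3^3"

text \<open>A constitutive mapping takes the point \<open>x\<close>, on which it may depend explicitly, the deformation
  gradient \<open>F\<close> and a vector (momentum, or velocity once the momentum has been eliminated).\<close>
type_synonym 'b constitutive = "vec3 \<Rightarrow> tensor \<Rightarrow> vec3 \<Rightarrow> 'b"

text \<open>Derivatives are taken within \<open>S\<close>. The definitions are used for open \<open>S\<close> and for
  \<open>\<real>\<^sup>3 \<times> [0, T)\<close>; there derivatives within \<open>S\<close> are unique, being one-sided in time at \<open>t = 0\<close>.\<close>
definition C1_on :: "('a::real_normed_vector \<Rightarrow> 'b::real_normed_vector) \<Rightarrow> 'a set \<Rightarrow> bool" where
  "C1_on f S \<longleftrightarrow> (\<exists>f' :: 'a \<Rightarrow> 'a \<Rightarrow>\<^sub>L 'b.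
     (\<forall>z\<in>S. (f has_derivative blinfun_apply (f' z)) (at z within S)) \<and> continuous_on S f')"

definition C2_on :: "('a::real_normed_vector \<Rightarrow> 'b::real_normed_vector) \<Rightarrow> 'a set \<Rightarrow> bool" where
  "C2_on f S \<longleftrightarrow> (\<exists>f' :: 'a \<Rightarrow> 'a \<Rightarrow>\<^sub>L 'b.
     (\<forall>z\<in>S. (f has_derivative blinfun_apply (f' z)) (at z within S)) \<and> C1_on f' S)"

definition C1_constitutive :: "'b::real_normed_vector constitutive \<Rightarrow> bool" where
  "C1_constitutive f \<longleftrightarrow> C1_on (\<lambda>(x, F, p). f x F p) UNIV"

definition C2_constitutive :: "'b::real_normed_vector constitutive \<Rightarrow> bool" where
  "C2_constitutive f \<longleftrightarrow> C2_on (\<lambda>(x, F, p). f x F p) UNIV"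

definition tensor_prod :: "vec3 \<Rightarrow> vec3 \<Rightarrow> tensor" where
  "tensor_prod b a = (\<chi> i j. b $ i * a $ j)"

definition pd_vec :: "3 \<Rightarrow> (vec3 \<Rightarrow> real) \<Rightarrow> vec3 \<Rightarrow> real" where
  "pd_vec k f p = frechet_derivative f (at p) (axis k 1)"

definition pd_tensor :: "3 \<Rightarrow> 3 \<Rightarrow> (tensor \<Rightarrow> real) \<Rightarrow> tensor \<Rightarrow> real" where
  "pd_tensor i j f F = frechet_derivative f (at F) (axis i (axis j 1))"

definition Grad :: "(vec3 \<Rightarrow> vec3) \<Rightarrow> vec3 \<Rightarrow> tensor" where
  "Grad v x = (\<chi> i j. pd_vec j (\<lambda>y. v y $ i) x)"

definition Div :: "(vec3 \<Rightarrow> tensor) \<Rightarrow> vec3 \<Rightarrow> vec3" where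
  "Div S x = (\<chi> i. \<Sum>j\<in>UNIV. pd_vec j (\<lambda>y. S y $ i $ j) x)"

definition time_deriv :: "(vec3 \<Rightarrow> real \<Rightarrow> 'b::real_normed_vector) \<Rightarrow> vec3 \<Rightarrow> real \<Rightarrow> 'b" where
  "time_deriv f x t = vector_derivative (f x) (at t)"

definition admissible_process ::
  "vec3 constitutive \<Rightarrow> tensor constitutive \<Rightarrow> real \<Rightarrow>
   (vec3 \<Rightarrow> real \<Rightarrow> tensor) \<Rightarrow> (vec3 \<Rightarrow> real \<Rightarrow> vec3) \<Rightarrow> bool" where
  "admissible_process vh Sh T F p \<longleftrightarrow>
     C1_on (\<lambda>(x, t). F x t) (UNIV \<times> {0<..<T}) \<and>
     C1_on (\<lambda>(x, t). p x t) (UNIV \<times> {0<..<T}) \<and>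
     (\<forall>x. \<forall>t\<in>{0<..<T}.
        time_deriv F x t = Grad (\<lambda>y. vh y (F y t) (p y t)) x \<and>
        time_deriv p x t = Div (\<lambda>y. Sh y (F y t) (p y t)) x)"

definition dissipation_inequality ::
  "vec3 constitutive \<Rightarrow> tensor constitutive \<Rightarrow> real constitutive \<Rightarrow> real \<Rightarrow>
   (vec3 \<Rightarrow> real \<Rightarrow> tensor) \<Rightarrow> (vec3 \<Rightarrow> real \<Rightarrow> vec3) \<Rightarrow> bool" where
  "dissipation_inequality vh Sh tauh T F p \<longleftrightarrow>
     (\<forall>x. \<forall>t\<in>{0<..<T}.
        time_deriv (\<lambda>y s. tauh y (F y s) (p y s)) x t
          \<le> Sh x (F x t) (p x t) \<bullet> time_deriv F x t + vh x (F x t) (p x t) \<bullet> time_deriv p x t)"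

definition normal_velocity :: "vec3 constitutive \<Rightarrow> bool" where
  "normal_velocity vh \<longleftrightarrow>
     (\<forall>x F p. invertible ((\<chi> i h. pd_vec h (\<lambda>q. vh x F q $ i) p) :: tensor))"

text \<open>\<open>ph\<close> expresses the momentum through the deformation gradient and the velocity. It is required
  for all velocities, because the affine initial velocities of the solvability condition attain
  every value. For normal \<open>vh\<close>, which is locally injective in the momentum, a continuous right
  inverse is automatically two-sided: the set of \<open>p\<close> with \<open>ph x F (vh x F p) = p\<close> is nonempty,
  open and closed.\<close>
definition momentum_inverse :: "vec3 constitutive \<Rightarrow> vec3 constitutive \<Rightarrow> bool" where
  "momentum_inverse vh ph \<longleftrightarrow>
     (\<forall>x F. continuous_on UNIV (ph x F) \<and> (\<forall>v. vh x F (ph x F v) = v))"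

text \<open>If \<open>vh\<close> is normal and \<open>vh\<close>, \<open>Sh\<close> are continuously differentiable, then by the inverse function
  theorem so are \<open>ph\<close> and the mapping below, so its Frechet derivatives are meaningful.\<close>
definition stress_tilde :: "tensor constitutive \<Rightarrow> vec3 constitutive \<Rightarrow> tensor constitutive" where
  "stress_tilde Sh ph x F v = Sh x F (ph x F v)"

definition ellipticity_matrix :: "tensor constitutive \<Rightarrow> vec3 \<Rightarrow> tensor \<Rightarrow> vec3 \<Rightarrow> vec3 \<Rightarrow> tensor" where
  "ellipticity_matrix St x F v a =
     (\<chi> i h. \<Sum>j\<in>UNIV. \<Sum>k\<in>UNIV. pd_tensor h k (\<lambda>G. St x G v $ i $ j) F * a $ j * a $ k)"

definition elliptic :: "tensor constitutive \<Rightarrow> bool" where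
  "elliptic St \<longleftrightarrow> (\<forall>x v a. a \<noteq> 0 \<longrightarrow> (\<forall>F. invertible (ellipticity_matrix St x F v a)))"

text \<open>Classical means continuously differentiable up to and including the initial time.\<close>
definition classical_solution ::
  "vec3 constitutive \<Rightarrow> tensor constitutive \<Rightarrow> real \<Rightarrow> (vec3 \<Rightarrow> tensor) \<Rightarrow> (vec3 \<Rightarrow> vec3) \<Rightarrow>
   (vec3 \<Rightarrow> real \<Rightarrow> tensor) \<Rightarrow> (vec3 \<Rightarrow> real \<Rightarrow> vec3) \<Rightarrow> bool" where
  "classical_solution ph St T F0 v0 F v \<longleftrightarrow>
     C1_on (\<lambda>(x, t). F x t) (UNIV \<times> {0..<T}) \<and>
     C1_on (\<lambda>(x, t). v x t) (UNIV \<times> {0..<T}) \<and>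
     (\<forall>x. \<forall>t\<in>{0<..<T}.
        time_deriv F x t = Grad (\<lambda>y. v y t) x \<and>
        time_deriv (\<lambda>y s. ph y (F y s) (v y s)) x t = Div (\<lambda>y. St y (F y t) (v y t)) x) \<and>
     (\<forall>x. F x 0 = F0 x \<and> v x 0 = v0 x)"

definition solvable :: "vec3 constitutive \<Rightarrow> tensor constitutive \<Rightarrow> real \<Rightarrow> bool" where
  "solvable ph St T \<longleftrightarrow>
     (\<forall>A a c. a \<noteq> 0 \<longrightarrow>
        (\<forall>B b xo. \<exists>F v. classical_solution ph St T
           (\<lambda>x. A + (a \<bullet> (x - xo)) *\<^sub>R tensor_prod b a)
           (\<lambda>x. B *v (x - xo) + c) F v))"

definition grad_momentum :: "real constitutive \<Rightarrow> vec3 constitutive" where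
  "grad_momentum f x F p = (\<chi> k. pd_vec k (f x F) p)"

definition grad_deformation :: "real constitutive \<Rightarrow> tensor constitutive" where
  "grad_deformation f x F p = (\<chi> i j. pd_tensor i j (\<lambda>G. f x G p) F)"

definition energy_relations ::
  "vec3 constitutive \<Rightarrow> tensor constitutive \<Rightarrow> real constitutive \<Rightarrow> bool" where
  "energy_relations vh Sh tauh \<longleftrightarrow>
     (\<forall>x F p. vh x F p = grad_momentum tauh x F p \<and> Sh x F p = grad_deformation tauh x F p)"

end

theory Submission
  imports Defs
begin

text \<open>Sufficiency is the chain rule, which even gives equality. For necessity fix \<open>x\<close>, \<open>A\<close>, \<open>p\<close>
  and solve the initial-value problem with \<open>c = vh x A p\<close> and \<open>xo = x\<close>. By the inverse function
  theorem the momentum inverse is two-sided and jointly continuously differentiable, so solutions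
  are admissible processes. Letting \<open>t\<close> tend to \<open>0\<close> in the dissipation inequality gives
  \<open>\<sigma> \<bullet> B + \<nu> \<bullet> (d B + E *v b) \<le> 0\<close> for all \<open>B\<close> and \<open>b\<close>, where \<open>\<sigma>\<close> and \<open>\<nu>\<close> are
  the defects in the two energy relations and \<open>E\<close> is the ellipticity matrix. As \<open>E\<close> is invertible,
  the second factor takes every value already for \<open>B = 0\<close>, hence \<open>\<nu> = 0\<close>, and then \<open>\<sigma> = 0\<close>.
  The reciprocity relations are the symmetry of the second derivative of the energy.\<close>

subsection \<open>Continuously differentiable maps and their inverses\<close>

lemma C1_on_compose:
  assumes f: "C1_on f S" and g: "C1_on g T" and sub: "f ` S \<subseteq> T"
  shows "C1_on (\<lambda>z. g (f z)) S"
proof -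
  obtain f' where f': "\<And>z. z \<in> S \<Longrightarrow> (f has_derivative blinfun_apply (f' z)) (at z within S)"
    and cf': "continuous_on S f'"
    using f unfolding C1_on_def by blast
  obtain g' where g': "\<And>z. z \<in> T \<Longrightarrow> (g has_derivative blinfun_apply (g' z)) (at z within T)"
    and cg': "continuous_on T g'"
    using g unfolding C1_on_def by blast
  have cf: "continuous_on S f"
    using f' has_derivative_continuous continuous_on_eq_continuous_within by blast
  have "((\<lambda>z. g (f z)) has_derivative blinfun_apply (g' (f z) o\<^sub>L f' z)) (at z within S)" if "z \<in> S" for z
  proof -
    have "f z \<in> T" using that sub by blast
    then have "((\<lambda>z. g (f z)) has_derivative (\<lambda>h. g' (f z) (f' z h))) (at z within S)"
      by (rule has_derivative_in_compose[OF f'[OF that] has_derivative_subset[OF g' sub]])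
    moreover have "(\<lambda>h. g' (f z) (f' z h)) = blinfun_apply (g' (f z) o\<^sub>L f' z)" by auto
    ultimately show ?thesis by simp
  qed
  moreover have "continuous_on S (\<lambda>z. g' (f z) o\<^sub>L f' z)"
    using cf' continuous_on_compose2[OF cg' cf sub]
    by (intro bounded_bilinear.continuous_on[OF bounded_bilinear_blinfun_compose])
  ultimately show ?thesis unfolding C1_on_def by (intro exI[of _ "\<lambda>z. g' (f z) o\<^sub>L f' z"]) simp
qed

lemma C1_on_bounded_linear: "bounded_linear f \<Longrightarrow> C1_on f S"
  unfolding C1_on_def
  by (intro exI[of _ "\<lambda>_. Blinfun f"])
    (auto simp: bounded_linear_Blinfun_apply bounded_linear_imp_has_derivative)

lemma C1_on_add:
  assumes "C1_on f S" and "C1_on g S"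
  shows "C1_on (\<lambda>z. f z + g z) S"
proof -
  obtain f' where "\<And>z. z \<in> S \<Longrightarrow> (f has_derivative blinfun_apply (f' z)) (at z within S)"
    and "continuous_on S f'"
    using assms(1) unfolding C1_on_def by blast
  moreover obtain g' where "\<And>z. z \<in> S \<Longrightarrow> (g has_derivative blinfun_apply (g' z)) (at z within S)"
    and "continuous_on S g'"
    using assms(2) unfolding C1_on_def by blast
  ultimately show ?thesis
    unfolding C1_on_def
    by (intro exI[of _ "\<lambda>z. f' z + g' z"])
      (auto simp: plus_blinfun.rep_eq intro!: has_derivative_add continuous_on_add)
qed

text \<open>Writing the pair as \<open>(f z, 0) + (0, g z)\<close> reduces the claim to sums and to
  composition with the bounded linear embeddings of the two factors.\<close>

lemma C1_on_Pair:
  assumes "C1_on f S" and "C1_on g S"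
  shows "C1_on (\<lambda>z. (f z, g z)) S"
proof -
  have "C1_on (\<lambda>z. (f z, 0)) S"
    by (rule C1_on_compose[OF assms(1), of "\<lambda>x. (x, 0)" UNIV])
      (auto intro!: C1_on_bounded_linear bounded_linear_Pair bounded_linear_ident bounded_linear_zero)
  moreover have "C1_on (\<lambda>z. (0, g z)) S"
    by (rule C1_on_compose[OF assms(2), of "\<lambda>x. (0, x)" UNIV])
      (auto intro!: C1_on_bounded_linear bounded_linear_Pair bounded_linear_ident bounded_linear_zero)
  ultimately have "C1_on (\<lambda>z. (f z, 0) + (0, g z)) S" by (rule C1_on_add)
  then show ?thesis by simp
qed

lemma C1_on_subset: "C1_on f T \<Longrightarrow> S \<subseteq> T \<Longrightarrow> C1_on f S"
  unfolding C1_on_def by (meson continuous_on_subset has_derivative_subset subsetD)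

lemma C1_on_fst: "C1_on fst S" and C1_on_snd: "C1_on snd S"
  by (auto intro: C1_on_bounded_linear bounded_linear_fst bounded_linear_snd)

text \<open>The resolvent identity \<open>B y - B z = B y (A z - A y) B z\<close> controls the
  increment of \<open>B\<close> by that of \<open>A\<close>, provided \<open>norm (B y)\<close>
  stays bounded near \<open>z\<close>; the same identity supplies that bound.\<close>

lemma continuous_on_blinfun_inverse:
  fixes A :: "'a::topological_space \<Rightarrow> 'b::real_normed_vector \<Rightarrow>\<^sub>L 'c::real_normed_vector"
  assumes A: "continuous_on S A"
    and BA: "\<And>y. y \<in> S \<Longrightarrow> B y o\<^sub>L A y = id_blinfun"
    and AB: "\<And>y. y \<in> S \<Longrightarrow> A y o\<^sub>L B y = id_blinfun"
  shows "continuous_on S B"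
  unfolding continuous_on_def
proof
  fix z assume z: "z \<in> S"
  have lim: "((\<lambda>y. norm (A z - A y)) \<longlongrightarrow> 0) (at z within S)"
    using A z unfolding continuous_on_def
    by (auto intro!: tendsto_eq_intros simp: tendsto_norm_zero_iff)
  have eq: "B y - B z = (B y o\<^sub>L (A z - A y)) o\<^sub>L B z" if "y \<in> S" for y
  proof (rule blinfun_eqI)
    fix i
    have "B y (A y j) = j" for j
      using BA[OF that] by (metis blinfun_apply_blinfun_compose blinfun_apply_id_blinfun)
    moreover have "A z (B z j) = j" for j
      using AB[OF z] by (metis blinfun_apply_blinfun_compose blinfun_apply_id_blinfun)
    ultimately show "(B y - B z) i = ((B y o\<^sub>L (A z - A y)) o\<^sub>L B z) i"
      by (simp add: blinfun.diff_left blinfun.diff_right)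
  qed
  have le: "norm (B y - B z) \<le> norm (B y) * (norm (A z - A y) * norm (B z))" if "y \<in> S" for y
  proof -
    have "norm (B y - B z) \<le> norm (B y o\<^sub>L (A z - A y)) * norm (B z)"
      unfolding eq[OF that] by (rule norm_blinfun_compose)
    also have "\<dots> \<le> (norm (B y) * norm (A z - A y)) * norm (B z)"
      by (intro mult_right_mono norm_blinfun_compose) simp
    finally show ?thesis by (simp add: mult.assoc)
  qed
  have lim2: "((\<lambda>y. norm (A z - A y) * norm (B z)) \<longlongrightarrow> 0) (at z within S)"
    using tendsto_mult_left_zero[OF lim] .
  \<comment> \<open>Below the threshold 1/2 the increment of \<open>B\<close> is at most half of
    \<open>norm (B y)\<close>. The triangle inequality absorbs this half and leaves
    \<open>norm (B y) \<le> 2 * norm (B z)\<close>.\<close>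
  then have "\<forall>\<^sub>F y in at z within S. norm (A z - A y) * norm (B z) < 1/2"
    by (rule order_tendstoD) simp
  then have "\<forall>\<^sub>F y in at z within S. norm (B y - B z) \<le> (2 * norm (B z)) * (norm (A z - A y) * norm (B z))"
  proof (rule eventually_elim2[where Q="\<lambda>y. y \<in> S"])
    show "\<forall>\<^sub>F y in at z within S. y \<in> S" by (simp add: eventually_at_filter)
  next
    fix y assume small: "norm (A z - A y) * norm (B z) < 1/2" and y: "y \<in> S"
    have "norm (B y - B z) \<le> norm (B y) * (1/2)"
      using le[OF y] small by (smt (verit) mult_left_mono norm_ge_zero)
    then have "norm (B y) \<le> 2 * norm (B z)"
      using norm_triangle_sub[of "B y" "B z"] by linarith
    then show "norm (B y - B z) \<le> (2 * norm (B z)) * (norm (A z - A y) * norm (B z))"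
      using le[OF y] by (meson mult_nonneg_nonneg mult_right_mono norm_ge_zero order_trans)
  qed
  then have "((\<lambda>y. B y - B z) \<longlongrightarrow> 0) (at z within S)"
    by (rule Lim_null_comparison) (use tendsto_mult_right_zero[OF lim2] in simp)
  then show "(B \<longlongrightarrow> B z) (at z within S)" by (simp add: LIM_zero_iff)
qed

lemma linear_blinfun_apply: "linear (blinfun_apply f)"
  by (simp add: blinfun.bounded_linear_right bounded_linear.linear)

text \<open>Adapts the inverse function theorem to an injective derivative: in finite dimension an
  injective linear endomorphism has a linear left inverse, which the library theorem takes as input.
  Since \<open>g (f z) = z\<close>, the derivative of the local inverse at \<open>f z\<close> is
  \<open>inv (f' z)\<close>.\<close>

lemma local_inverse:
  fixes f :: "'a::euclidean_space \<Rightarrow> 'a" and f' :: "'a \<Rightarrow> 'a \<Rightarrow>\<^sub>L 'a"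
  assumes f': "\<And>z. (f has_derivative f' z) (at z)"
    and "continuous_on UNIV f'" and inj: "inj (f' z)"
  obtains U V g where "open U" and "z \<in> U" and "open V" and "f z \<in> V"
    and "homeomorphism U V f g" and "(g has_derivative inv (f' z)) (at (f z))"
proof -
  have "linear (f' z)" by (simp add: linear_blinfun_apply)
  then obtain L where L: "linear L" "L \<circ> f' z = id"
    using inj linear_injective_left_inverse by blast
  then have "bounded_linear L" by (simp add: linear_conv_bounded_linear)
  then have inv: "Blinfun L o\<^sub>L f' z = id_blinfun"
    using L(2) by (intro blinfun_eqI) (simp add: bounded_linear_Blinfun_apply pointfree_idE)
  obtain U V g g' where *: "open U" "U \<subseteq> UNIV" "z \<in> U" "open V" "f z \<in> V" "homeomorphism U V f g"
    "\<And>y. y \<in> V \<Longrightarrow> (g has_derivative (g' y)) (at y)"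
    "\<And>y. y \<in> V \<Longrightarrow> g' y = inv (blinfun_apply (f' (g y)))"
    "\<And>y. y \<in> V \<Longrightarrow> bij (blinfun_apply (f' (g y)))"
    by (rule inverse_function_theorem[OF open_UNIV f' \<open>continuous_on UNIV f'\<close> UNIV_I inv])
      (rule that; assumption)
  have "g (f z) = z" using *(3,6) by (simp add: homeomorphism_def)
  then have "(g has_derivative inv (f' z)) (at (f z))" using *(7,8)[OF *(5)] by simp
  then show ?thesis by (rule that[OF *(1,3-6)])
qed

text \<open>Near each point the global inverse \<open>g\<close> coincides with the local one,
  because applying \<open>g\<close> to \<open>f (k x) = x\<close> gives \<open>k x = g x\<close>. So
  \<open>g\<close> inherits the derivative \<open>inv (f' (g y))\<close>, which depends continuously
  on \<open>y\<close> by continuity of operator inversion.\<close>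

lemma C1_on_inverse:
  fixes f :: "'a::euclidean_space \<Rightarrow> 'a" and f' :: "'a \<Rightarrow> 'a \<Rightarrow>\<^sub>L 'a"
  assumes f': "\<And>z. (f has_derivative f' z) (at z)"
    and cont: "continuous_on UNIV f'" and inj: "\<And>z. inj (f' z)"
    and gf: "\<And>z. g (f z) = z" and fg: "\<And>y. f (g y) = y"
  shows "C1_on g UNIV"
proof -
  have "(g has_derivative inv (f' (g y))) (at y) \<and> isCont g y" for y
  proof -
    obtain U V k where "open V" "f (g y) \<in> V" "homeomorphism U V f k"
      "(k has_derivative inv (f' (g y))) (at (f (g y)))"
      by (rule local_inverse[OF f' cont inj, of "g y"]) (rule that; assumption)
    then have *: "open V" "y \<in> V" "homeomorphism U V f k"
      "(k has_derivative inv (f' (g y))) (at y)"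
      by (simp_all add: fg)
    have k: "k x = g x" if "x \<in> V" for x
    proof -
      have "f (k x) = x" using *(3) that by (simp add: homeomorphism_def)
      then show ?thesis using gf[of "k x"] by simp
    qed
    have "(g has_derivative inv (f' (g y))) (at y)"
      using has_derivative_transform_within_open[OF *(4,1,2) k] .
    then show ?thesis using has_derivative_continuous by blast
  qed
  then have der: "\<And>y. (g has_derivative inv (f' (g y))) (at y)" and "continuous_on UNIV g"
    by (simp_all add: continuous_at_imp_continuous_on)
  define B where "B y = Blinfun (inv (f' (g y)))" for y
  have B: "blinfun_apply (B y) = inv (f' (g y))" for y
    unfolding B_def using der by (intro bounded_linear_Blinfun_apply) (rule has_derivative_bounded_linear)
  have bij: "bij (f' z)" for z
    using inj linear_injective_imp_surjective[of "f' z"] by (simp add: bijI linear_blinfun_apply)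
  have "continuous_on UNIV (\<lambda>y. f' (g y))"
    using continuous_on_compose2[OF cont \<open>continuous_on UNIV g\<close>] by simp
  then have "continuous_on UNIV B"
  proof (rule continuous_on_blinfun_inverse)
    show "B y o\<^sub>L f' (g y) = id_blinfun" for y
      by (rule blinfun_eqI) (simp add: B inv_f_f[OF inj])
    show "f' (g y) o\<^sub>L B y = id_blinfun" for y
      by (rule blinfun_eqI) (simp add: B surj_f_inv_f[OF bij_is_surj[OF bij]])
  qed
  then show ?thesis
    unfolding C1_on_def using der by (intro exI[of _ B]) (simp add: B)
qed

text \<open>Local injectivity makes the set of \<open>z\<close> with \<open>g (f z) = z\<close> open; it is closed and nonempty as well.\<close>
lemma continuous_right_inverse_imp_left_inverse:
  fixes f :: "'a::euclidean_space \<Rightarrow> 'a" and f' :: "'a \<Rightarrow> 'a \<Rightarrow>\<^sub>L 'a"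
  assumes f': "\<And>z. (f has_derivative f' z) (at z)"
    and cont: "continuous_on UNIV f'" and inj: "\<And>z. inj (f' z)"
    and fg: "\<And>y. f (g y) = y" and cg: "continuous_on UNIV g"
  shows "g (f z) = z"
proof -
  have cf: "continuous_on UNIV f"
    by (intro continuous_at_imp_continuous_on ballI has_derivative_continuous[OF f'])
  then have cgf: "continuous_on UNIV (\<lambda>z. g (f z))"
    using continuous_on_compose2[OF cg] by simp
  define D where "D = {z. g (f z) = z}"
  have "closed D"
    unfolding D_def using cgf by (intro closed_Collect_eq) auto
  moreover have "open D"
    unfolding open_subopen[of D]
  proof
    fix z assume z: "z \<in> D"
    obtain U V k where U: "open U" "z \<in> U" and hom: "homeomorphism U V f k"
      by (rule local_inverse[OF f' cont inj, of z]) (rule that; assumption)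
    have inj: "inj_on f U"
      by (rule inj_on_inverseI[of _ k]) (use hom in \<open>simp add: homeomorphism_def\<close>)
    \<comment> \<open>On this set both \<open>z\<close> and \<open>g (f z)\<close> lie in
      \<open>U\<close> and have the same image under \<open>f\<close>, so injectivity on
      \<open>U\<close> identifies them.\<close>
    let ?W = "U \<inter> (\<lambda>z. g (f z)) -` U"
    have "open ?W" using U(1) cgf by (intro open_Int) (auto intro: open_vimage)
    moreover have "z \<in> ?W" using U(2) z by (simp add: D_def)
    moreover have "?W \<subseteq> D" using inj_onD[OF inj fg] by (auto simp: D_def)
    ultimately show "\<exists>W. open W \<and> z \<in> W \<and> W \<subseteq> D" by blast
  qed
  moreover have "g 0 \<in> D" by (simp add: D_def fg)
  ultimately have "D = UNIV" using clopen[of D] by auto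
  then show ?thesis by (auto simp: D_def)
qed

subsection \<open>Symmetry of second derivatives\<close>

text \<open>The mean value theorem is applied twice to the second difference over the parallelogram
  spanned by \<open>s u\<close> and \<open>s v\<close>: first along \<open>u\<close> to the
  increment in direction \<open>v\<close>, then along \<open>v\<close> to the derivative in
  direction \<open>u\<close>. This order of differentiation accounts for the argument order
  \<open>v u\<close> of \<open>f''\<close>.\<close>

lemma second_difference_mvt:
  fixes f :: "'a::real_normed_vector \<Rightarrow> real"
  assumes f': "\<And>z. (f has_derivative blinfun_apply (f' z)) (at z)"
    and f'': "\<And>z. (f' has_derivative blinfun_apply (f'' z)) (at z)"
    and s: "0 < s"
  shows "\<exists>r q. 0 < r \<and> r < s \<and> 0 < q \<and> q < s \<and>
    f (z + s *\<^sub>R u + s *\<^sub>R v) - f (z + s *\<^sub>R u) - f (z + s *\<^sub>R v) + f z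
      = s * s * f'' (z + r *\<^sub>R u + q *\<^sub>R v) v u"
proof -
  define \<phi> where "\<phi> r = f (z + r *\<^sub>R u + s *\<^sub>R v) - f (z + r *\<^sub>R u)" for r
  have "(\<phi> has_real_derivative f' (z + r *\<^sub>R u + s *\<^sub>R v) u - f' (z + r *\<^sub>R u) u) (at r)" for r
    unfolding \<phi>_def has_field_derivative_def
    by (rule has_derivative_eq_rhs)
      (auto intro!: derivative_eq_intros has_derivative_compose[OF _ f'] simp: blinfun.scaleR_right algebra_simps)
  from MVT2[OF s this] obtain r where r: "0 < r" "r < s"
    "\<phi> s - \<phi> 0 = s * (f' (z + r *\<^sub>R u + s *\<^sub>R v) u - f' (z + r *\<^sub>R u) u)"
    by auto
  define \<psi> where "\<psi> q = f' (z + r *\<^sub>R u + q *\<^sub>R v) u" for q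
  have "(\<psi> has_real_derivative f'' (z + r *\<^sub>R u + q *\<^sub>R v) v u) (at q)" for q
    unfolding \<psi>_def has_field_derivative_def
    by (rule has_derivative_eq_rhs)
      (auto intro!: derivative_eq_intros has_derivative_compose[OF _ f''] simp: blinfun.scaleR_right blinfun.scaleR_left algebra_simps)
  from MVT2[OF s this] obtain q where q: "0 < q" "q < s" "\<psi> s - \<psi> 0 = s * f'' (z + r *\<^sub>R u + q *\<^sub>R v) v u"
    by auto
  show ?thesis
    using r q by (intro exI[of _ r] exI[of _ q]) (auto simp: \<phi>_def \<psi>_def)
qed

text \<open>Schwarz's theorem. The second difference is symmetric in \<open>u\<close> and
  \<open>v\<close>; evaluating it in both orders yields equal values of \<open>f''\<close> at two
  intermediate points, which merge into \<open>z\<close> as the parallelogram shrinks.\<close>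

lemma second_derivative_symmetric:
  fixes f :: "'a::real_normed_vector \<Rightarrow> real"
  assumes f': "\<And>z. (f has_derivative blinfun_apply (f' z)) (at z)"
    and f'': "\<And>z. (f' has_derivative blinfun_apply (f'' z)) (at z)"
    and cont: "continuous_on UNIV f''"
  shows "f'' z u v = f'' z v u"
proof -
  define s where "s n = inverse (real (Suc n))" for n
  have s: "0 < s n" for n by (simp add: s_def)
  have s0: "s \<longlonglongrightarrow> 0" unfolding s_def by (rule LIMSEQ_inverse_real_of_nat)
  have "\<exists>r q r' q'. 0 < r \<and> r < s n \<and> 0 < q \<and> q < s n \<and> 0 < r' \<and> r' < s n \<and> 0 < q' \<and> q' < s n \<and>
     f'' (z + r *\<^sub>R u + q *\<^sub>R v) v u = f'' (z + r' *\<^sub>R v + q' *\<^sub>R u) u v" for n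
  proof -
    obtain r q r' q' where *: "0 < r" "r < s n" "0 < q" "q < s n" "0 < r'" "r' < s n" "0 < q'" "q' < s n"
      and 1: "f (z + s n *\<^sub>R u + s n *\<^sub>R v) - f (z + s n *\<^sub>R u) - f (z + s n *\<^sub>R v) + f z
        = s n * s n * f'' (z + r *\<^sub>R u + q *\<^sub>R v) v u"
      and 2: "f (z + s n *\<^sub>R v + s n *\<^sub>R u) - f (z + s n *\<^sub>R v) - f (z + s n *\<^sub>R u) + f z
        = s n * s n * f'' (z + r' *\<^sub>R v + q' *\<^sub>R u) u v"
      using second_difference_mvt[OF f' f'' s[of n], of z u v] second_difference_mvt[OF f' f'' s[of n], of z v u]
      by blast
    have "z + s n *\<^sub>R u + s n *\<^sub>R v = z + s n *\<^sub>R v + s n *\<^sub>R u" by simp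
    then have "s n * s n * f'' (z + r *\<^sub>R u + q *\<^sub>R v) v u = s n * s n * f'' (z + r' *\<^sub>R v + q' *\<^sub>R u) u v"
      using 1 2 by (simp add: algebra_simps)
    then have "f'' (z + r *\<^sub>R u + q *\<^sub>R v) v u = f'' (z + r' *\<^sub>R v + q' *\<^sub>R u) u v"
      using s[of n] by simp
    then show ?thesis using * by blast
  qed
  then obtain r q r' q' where *: "\<And>n. 0 < r n \<and> r n < s n \<and> 0 < q n \<and> q n < s n \<and>
      0 < r' n \<and> r' n < s n \<and> 0 < q' n \<and> q' n < s n \<and>
     f'' (z + r n *\<^sub>R u + q n *\<^sub>R v) v u = f'' (z + r' n *\<^sub>R v + q' n *\<^sub>R u) u v"
    by metis
  \<comment> \<open>The intermediate parameters are squeezed between 0 and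
    \<open>s n\<close>.\<close>
  have null: "a \<longlonglongrightarrow> 0" if "\<And>n. 0 < a n \<and> a n < s n" for a
    by (rule tendsto_sandwich[OF _ _ tendsto_const s0]) (auto intro!: always_eventually less_imp_le simp: that)
  have lim: "(\<lambda>n. f'' (z + a n *\<^sub>R x + b n *\<^sub>R y) h k) \<longlonglongrightarrow> f'' z h k"
    if "a \<longlonglongrightarrow> 0" "b \<longlonglongrightarrow> 0" for a b x y h k
  proof -
    have "(\<lambda>n. z + a n *\<^sub>R x + b n *\<^sub>R y) \<longlonglongrightarrow> z"
      using that by (auto intro!: tendsto_eq_intros)
    then have "(\<lambda>n. f'' (z + a n *\<^sub>R x + b n *\<^sub>R y)) \<longlonglongrightarrow> f'' z"
      using cont by (auto simp: continuous_on_eq_continuous_at intro: isCont_tendsto_compose)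
    then show ?thesis by (intro tendsto_intros)
  qed
  have "(\<lambda>n. f'' (z + r n *\<^sub>R u + q n *\<^sub>R v) v u) \<longlonglongrightarrow> f'' z v u"
    using * by (intro lim null) auto
  moreover have "(\<lambda>n. f'' (z + r' n *\<^sub>R v + q' n *\<^sub>R u) u v) \<longlonglongrightarrow> f'' z u v"
    using * by (intro lim null) auto
  then have "(\<lambda>n. f'' (z + r n *\<^sub>R u + q n *\<^sub>R v) v u) \<longlonglongrightarrow> f'' z u v"
    using * by simp
  ultimately show ?thesis using LIMSEQ_unique by blast
qed

subsection \<open>Partial derivatives of constitutive mappings and fields\<close>

lemma pd_vec_eq: "(f has_derivative f') (at p) \<Longrightarrow> pd_vec k f p = f' (axis k 1)"
  unfolding pd_vec_def using frechet_derivative_at by metis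

lemma pd_tensor_eq: "(f has_derivative f') (at F) \<Longrightarrow> pd_tensor i j f F = f' (axis i (axis j 1))"
  unfolding pd_tensor_def using frechet_derivative_at by metis

lemma has_derivative_vec_nth:
  "(f has_derivative f') F \<Longrightarrow> ((\<lambda>y. f y $ i) has_derivative (\<lambda>h. f' h $ i)) F"
  by (rule bounded_linear.has_derivative[OF bounded_linear_vec_nth])

lemma Grad_eq:
  assumes "(v has_derivative v') (at x)"
  shows "Grad v x = (\<chi> i j. v' (axis j 1) $ i)"
  unfolding Grad_def using pd_vec_eq[OF has_derivative_vec_nth[OF assms]] by simp

lemma Div_eq:
  assumes "(S has_derivative S') (at x)"
  shows "Div S x = (\<chi> i. \<Sum>j\<in>UNIV. S' (axis j 1) $ i $ j)"
  unfolding Div_def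
  using pd_vec_eq[OF has_derivative_vec_nth[OF has_derivative_vec_nth[OF assms]]] by simp

lemma linear_vec3_expand:
  fixes L :: "vec3 \<Rightarrow> 'b::real_vector"
  assumes "linear L"
  shows "L q = (\<Sum>k\<in>UNIV. q $ k *\<^sub>R L (axis k 1))"
proof -
  have "q = (\<Sum>k\<in>UNIV. q $ k *\<^sub>R axis k 1)"
    by (simp add: vec_eq_iff forall_3 sum_3 axis_def)
  then have "L q = L (\<Sum>k\<in>UNIV. q $ k *\<^sub>R axis k 1)" by simp
  then show ?thesis using assms by (simp add: linear_sum linear_scale)
qed

lemma linear_tensor_expand:
  fixes L :: "tensor \<Rightarrow> 'b::real_vector"
  assumes "linear L"
  shows "L B = (\<Sum>i\<in>UNIV. \<Sum>j\<in>UNIV. B $ i $ j *\<^sub>R L (axis i (axis j 1)))"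
proof -
  have "B = (\<Sum>i\<in>UNIV. \<Sum>j\<in>UNIV. B $ i $ j *\<^sub>R axis i (axis j 1))"
    by (simp add: vec_eq_iff forall_3 sum_3 axis_def)
  then have "L B = L (\<Sum>i\<in>UNIV. \<Sum>j\<in>UNIV. B $ i $ j *\<^sub>R axis i (axis j 1))" by simp
  then show ?thesis using assms by (simp add: linear_sum linear_scale)
qed

lemma constitutive_partial_vec:
  assumes "((\<lambda>(x, F, p). f x F p) has_derivative D) (at (x, F, p))"
  shows "(f x F has_derivative (\<lambda>q. D (0, 0, q))) (at p)"
proof -
  have "((\<lambda>q. (x, F, q)) has_derivative (\<lambda>q. (0, 0, q))) (at p)"
    by (auto intro!: derivative_eq_intros)
  from has_derivative_compose[OF this assms] show ?thesis by simp
qed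

lemma constitutive_partial_tensor:
  assumes "((\<lambda>(x, F, p). f x F p) has_derivative D) (at (x, F, p))"
  shows "((\<lambda>G. f x G p) has_derivative (\<lambda>G. D (0, G, 0))) (at F)"
proof -
  have "((\<lambda>G. (x, G, p)) has_derivative (\<lambda>G. (0, G, 0))) (at F)"
    by (auto intro!: derivative_eq_intros)
  from has_derivative_compose[OF this assms] show ?thesis by simp
qed

text \<open>The first slot is 0 because the material point stays fixed along a process. The
  remaining differential splits by linearity, and its two parts are represented by the gradients
  with respect to the componentwise inner products.\<close>

lemma energy_differential:
  assumes D: "((\<lambda>(x, F, p). tauh x F p) has_derivative D) (at (x, F, p))"
  shows "D (0, B, w) = grad_deformation tauh x F p \<bullet> B + grad_momentum tauh x F p \<bullet> w"
proof -
  have lin: "linear D" using D has_derivative_linear by blast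
  have "D (0, B, w) = D (0, B, 0) + D (0, 0, w)"
    using linear_add[OF lin, of "(0, B, 0)" "(0, 0, w)"] by simp
  moreover have "D (0, 0, w) = grad_momentum tauh x F p \<bullet> w"
    using constitutive_partial_vec[OF D]
    by (subst linear_vec3_expand[OF has_derivative_linear])
      (auto simp: grad_momentum_def inner_vec_def pd_vec_eq mult.commute)
  moreover have "D (0, B, 0) = grad_deformation tauh x F p \<bullet> B"
    using constitutive_partial_tensor[OF D]
    by (subst linear_tensor_expand[OF has_derivative_linear])
      (auto simp: grad_deformation_def inner_vec_def pd_tensor_eq mult.commute)
  ultimately show ?thesis by simp
qed

text \<open>The whole slice at time \<open>t\<close> lies in \<open>UNIV \<times> I\<close>, so the
  spatial derivative is unrestricted even when \<open>t\<close> is a boundary point of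
  \<open>I\<close>. This makes \<open>Grad\<close> and \<open>Div\<close> available at the initial
  time.\<close>

lemma space_slice_has_derivative:
  assumes "((\<lambda>(x, t). g x t) has_derivative g') (at (x, t) within UNIV \<times> I)" and "t \<in> I"
  shows "((\<lambda>y. g y t) has_derivative (\<lambda>h. g' (h, 0))) (at x)"
proof -
  have "((\<lambda>y. (y, t)) has_derivative (\<lambda>h. (h, 0))) (at x)"
    by (auto intro!: derivative_eq_intros)
  moreover have "((\<lambda>(x, t). g x t) has_derivative g') (at (x, t) within range (\<lambda>y. (y, t)))"
    using assms by (auto intro: has_derivative_subset)
  ultimately show ?thesis using has_derivative_in_compose[of "\<lambda>y. (y, t)"] by fastforce
qed

text \<open>Openness of \<open>I\<close> turns the derivative within the set into a two-sided time
  derivative, as \<open>time_deriv\<close> requires.\<close>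

lemma time_slice_has_derivative:
  assumes g: "((\<lambda>(x, t). g x t) has_derivative g') (at (x, t) within UNIV \<times> I)"
    and "open I" and "t \<in> I"
  shows "(g x has_derivative (\<lambda>r. g' (0, r))) (at t)"
proof -
  have "open (UNIV \<times> I)" using \<open>open I\<close> by (intro open_Times) auto
  then have "((\<lambda>(x, t). g x t) has_derivative g') (at (x, t))"
    using g \<open>t \<in> I\<close> by (metis at_within_open mem_Sigma_iff UNIV_I)
  moreover have "((\<lambda>s. (x, s)) has_derivative (\<lambda>r. (0, r))) (at t)"
    by (auto intro!: derivative_eq_intros)
  ultimately show ?thesis using has_derivative_compose[of "\<lambda>s. (x, s)"] by fastforce
qed

text \<open>Together with its counterpart for \<open>Div\<close>, this is applied with
  \<open>I = {0..<T}\<close>, where continuity at 0 is what carries the dissipation inequality over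
  to the initial data.\<close>

lemma continuous_on_Grad:
  assumes "C1_on (\<lambda>(x, t). v x t) (UNIV \<times> I)"
  shows "continuous_on I (\<lambda>t. Grad (\<lambda>y. v y t) x)"
proof -
  obtain v' where v': "\<And>z. z \<in> UNIV \<times> I \<Longrightarrow>
      ((\<lambda>(x, t). v x t) has_derivative blinfun_apply (v' z)) (at z within UNIV \<times> I)"
    and cont: "continuous_on (UNIV \<times> I) v'"
    using assms unfolding C1_on_def by blast
  have "Grad (\<lambda>y. v y t) x = (\<chi> i j. v' (x, t) (axis j 1, 0) $ i)" if "t \<in> I" for t
    using that by (intro Grad_eq space_slice_has_derivative[OF v']) auto
  moreover have "continuous_on I (\<lambda>t. v' (x, t))"
    by (rule continuous_on_compose2[OF cont]) (auto intro!: continuous_intros)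
  then have "continuous_on I (\<lambda>t. (\<chi> i j. v' (x, t) (axis j 1, 0) $ i) :: tensor)"
    by (intro continuous_intros)
  ultimately show ?thesis by (simp cong: continuous_on_cong)
qed

lemma continuous_on_Div:
  assumes "C1_on (\<lambda>(x, t). S x t) (UNIV \<times> I)"
  shows "continuous_on I (\<lambda>t. Div (\<lambda>y. S y t) x)"
proof -
  obtain S' where S': "\<And>z. z \<in> UNIV \<times> I \<Longrightarrow>
      ((\<lambda>(x, t). S x t) has_derivative blinfun_apply (S' z)) (at z within UNIV \<times> I)"
    and cont: "continuous_on (UNIV \<times> I) S'"
    using assms unfolding C1_on_def by blast
  have "Div (\<lambda>y. S y t) x = (\<chi> i. \<Sum>j\<in>UNIV. S' (x, t) (axis j 1, 0) $ i $ j)" if "t \<in> I" for t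
    using that by (intro Div_eq space_slice_has_derivative[OF S']) auto
  moreover have "continuous_on I (\<lambda>t. S' (x, t))"
    by (rule continuous_on_compose2[OF cont]) (auto intro!: continuous_intros)
  then have "continuous_on I (\<lambda>t. (\<chi> i. \<Sum>j\<in>UNIV. S' (x, t) (axis j 1, 0) $ i $ j) :: vec3)"
    by (intro continuous_intros)
  ultimately show ?thesis by (simp cong: continuous_on_cong)
qed

lemma C1_on_constitutive_compose:
  assumes "C1_constitutive f" and "C1_on (\<lambda>(x, t). F x t) (UNIV \<times> I)"
    and "C1_on (\<lambda>(x, t). p x t) (UNIV \<times> I)"
  shows "C1_on (\<lambda>(x, t). f x (F x t) (p x t)) (UNIV \<times> I)"
proof -
  have "C1_on (\<lambda>z. (fst z, F (fst z) (snd z), p (fst z) (snd z))) (UNIV \<times> I)"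
    using assms(2,3) by (intro C1_on_Pair C1_on_fst) (simp_all add: case_prod_unfold)
  from C1_on_compose[OF this assms(1)[unfolded C1_constitutive_def]] show ?thesis
    by (simp add: case_prod_unfold)
qed

lemma C1_on_has_derivative:
  assumes "C1_on f S" and "z \<in> S"
  obtains D where "(f has_derivative D) (at z within S)"
  using assms unfolding C1_on_def by blast

lemma C1_constitutiveE:
  assumes "C1_constitutive f"
  obtains f' where "\<And>z. ((\<lambda>(x, F, p). f x F p) has_derivative blinfun_apply (f' z)) (at z)"
    and "continuous_on UNIV f'"
  using assms unfolding C1_constitutive_def C1_on_def by auto

text \<open>Chain rule along the curve \<open>s \<mapsto> (x, F x s, p x s)\<close>; its first
  component is constant, whence the 0 in the first slot.\<close>

lemma time_deriv_energy:
  assumes F: "C1_on (\<lambda>(x, t). F x t) (UNIV \<times> {0<..<T})"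
    and p: "C1_on (\<lambda>(x, t). p x t) (UNIV \<times> {0<..<T})"
    and t: "t \<in> {0<..<T}"
    and D: "((\<lambda>(x, F, p). tauh x F p) has_derivative D) (at (x, F x t, p x t))"
  shows "time_deriv (\<lambda>y s. tauh y (F y s) (p y s)) x t
    = D (0, time_deriv F x t, time_deriv p x t)"
proof -
  have xt: "(x, t) \<in> UNIV \<times> {0<..<T}" using t by simp
  obtain F' where F': "((\<lambda>(x, t). F x t) has_derivative F') (at (x, t) within UNIV \<times> {0<..<T})"
    using F xt by (rule C1_on_has_derivative)
  obtain p' where p': "((\<lambda>(x, t). p x t) has_derivative p') (at (x, t) within UNIV \<times> {0<..<T})"
    using p xt by (rule C1_on_has_derivative)
  have "F x differentiable at t" "p x differentiable at t"
    using time_slice_has_derivative[OF F' _ t] time_slice_has_derivative[OF p' _ t]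
    unfolding differentiable_def by auto
  then have "(F x has_vector_derivative time_deriv F x t) (at t)"
    "(p x has_vector_derivative time_deriv p x t) (at t)"
    unfolding time_deriv_def by (simp_all add: vector_derivative_works)
  then have "((\<lambda>s. (x, F x s, p x s)) has_vector_derivative (0, time_deriv F x t, time_deriv p x t)) (at t)"
    by (intro has_vector_derivative_Pair has_vector_derivative_const)
  from has_derivative_compose[OF this[unfolded has_vector_derivative_def] D]
  have "((\<lambda>s. tauh x (F x s) (p x s)) has_vector_derivative D (0, time_deriv F x t, time_deriv p x t)) (at t)"
    unfolding has_vector_derivative_def
    using linear_scale[OF has_derivative_linear[OF D], of _ "(0, time_deriv F x t, time_deriv p x t)"]
    by simp
  then show ?thesis unfolding time_deriv_def by (rule vector_derivative_at)
qed

subsection \<open>The momentum inverse\<close>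

text \<open>The derivative in the momentum acts as multiplication by the matrix of condition (N),
  and a left inverse of that matrix gives injectivity.\<close>

lemma normal_velocity_inj:
  assumes N: "normal_velocity vh"
    and D: "(vh x F has_derivative D) (at p)"
  shows "inj D"
proof -
  let ?N = "(\<chi> i h. pd_vec h (\<lambda>q. vh x F q $ i) p) :: tensor"
  have lin: "linear D" using D has_derivative_linear by blast
  have "D q = ?N *v q" for q
    by (subst linear_vec3_expand[OF lin])
      (simp add: vec_eq_iff matrix_vector_mult_def pd_vec_eq[OF has_derivative_vec_nth[OF D]] mult.commute)
  moreover obtain M where "M ** ?N = mat 1"
    using N unfolding normal_velocity_def invertible_def by blast
  then have "inj ((*v) ?N)" using matrix_left_invertible_injective by blast
  ultimately show ?thesis by (simp add: inj_def)
qed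

lemma momentum_inverse_left:
  assumes "C1_constitutive vh" and N: "normal_velocity vh" and inv: "momentum_inverse vh ph"
  shows "ph x F (vh x F p) = p"
proof -
  obtain V where V: "\<And>z. ((\<lambda>(x, F, p). vh x F p) has_derivative blinfun_apply (V z)) (at z)"
    and cont: "continuous_on UNIV V"
    using assms(1) by (rule C1_constitutiveE) (rule that; assumption)
  have bl: "bounded_linear (\<lambda>q::vec3. (0::vec3, 0::tensor, q))"
    by (intro bounded_linear_Pair bounded_linear_zero bounded_linear_ident)
  \<comment> \<open>The partial derivative in the momentum, obtained by composing the total
    derivative with the inclusion of the momentum slot; in this form it inherits continuity from
    \<open>V\<close>.\<close>
  define W where "W q = V (x, F, q) o\<^sub>L Blinfun (\<lambda>q. (0, 0, q))" for q
  have W: "blinfun_apply (W q) = (\<lambda>h. V (x, F, q) (0, 0, h))" for q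
    by (simp add: W_def fun_eq_iff bounded_linear_Blinfun_apply[OF bl])
  have der: "(vh x F has_derivative W q) (at q)" for q
    unfolding W by (rule constitutive_partial_vec[OF V])
  have "continuous_on UNIV (\<lambda>q. V (x, F, q))"
    by (rule continuous_on_compose2[OF cont]) (auto intro!: continuous_intros)
  then have "continuous_on UNIV W"
    unfolding W_def
    by (intro bounded_bilinear.continuous_on[OF bounded_bilinear_blinfun_compose] continuous_on_const)
  moreover have "continuous_on UNIV (ph x F)" and "\<And>v. vh x F (ph x F v) = v"
    using inv unfolding momentum_inverse_def by simp_all
  ultimately show ?thesis
    using continuous_right_inverse_imp_left_inverse[OF der _ normal_velocity_inj[OF N der]] by metis
qed

text \<open>\<open>momentum_inverse\<close> asks only for continuity in the velocity at fixed
  \<open>x\<close> and \<open>F\<close>. Joint regularity follows by inverting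
  \<open>\<Phi> (x, F, p) = (x, F, vh x F p)\<close> on the full product space and reading
  \<open>ph\<close> off the last component of its inverse \<open>\<Psi>\<close>.\<close>

lemma C1_momentum_inverse:
  assumes vh: "C1_constitutive vh" and N: "normal_velocity vh" and inv: "momentum_inverse vh ph"
  shows "C1_constitutive ph"
proof -
  define \<Phi> where "\<Phi> = (\<lambda>(x, F, p). (x, F, vh x F p))"
  define \<Psi> where "\<Psi> = (\<lambda>(x, F, v). (x, F, ph x F v))"
  have "C1_on (\<lambda>z. (fst z, fst (snd z), (\<lambda>(x, F, p). vh x F p) z)) UNIV"
    using vh unfolding C1_constitutive_def
    by (intro C1_on_Pair C1_on_fst C1_on_compose[OF C1_on_snd C1_on_fst subset_UNIV])
  then have "C1_on \<Phi> UNIV" by (simp add: \<Phi>_def case_prod_unfold)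
  then obtain \<Phi>' where der: "\<And>z. (\<Phi> has_derivative blinfun_apply (\<Phi>' z)) (at z)"
    and cont: "continuous_on UNIV \<Phi>'"
    unfolding C1_on_def by auto
  obtain V where V: "\<And>z. ((\<lambda>(x, F, p). vh x F p) has_derivative blinfun_apply (V z)) (at z)"
    using vh by (rule C1_constitutiveE) (rule that; assumption)
  have \<Phi>': "\<Phi>' z h = (fst h, fst (snd h), V z h)" for z h
  proof -
    have "((\<lambda>z. (fst z, fst (snd z), (\<lambda>(x, F, p). vh x F p) z)) has_derivative
      (\<lambda>h. (fst h, fst (snd h), V z h))) (at z)"
      by (intro has_derivative_Pair V derivative_intros)
    then have "(\<Phi> has_derivative (\<lambda>h. (fst h, fst (snd h), V z h))) (at z)"
      by (simp add: \<Phi>_def case_prod_unfold)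
    from has_derivative_unique[OF der this] show ?thesis by simp
  qed
  \<comment> \<open>The derivative of \<open>\<Phi>\<close> is block triangular: a kernel vector has
    vanishing first two components, and then normality kills the third.\<close>
  have "inj (\<Phi>' z)" for z
  proof -
    obtain x F p where z: "z = (x, F, p)" by (cases z)
    have "inj (\<lambda>q. V z (0, 0, q))"
      unfolding z by (rule normal_velocity_inj[OF N constitutive_partial_vec[OF V]])
    moreover have "V z (0, 0, 0) = 0" by (simp flip: zero_prod_def add: blinfun.zero_right)
    ultimately have "h = 0" if "\<Phi>' z h = 0" for h
      using that injD[of "\<lambda>q. V z (0, 0, q)" "snd (snd h)" 0]
      by (cases h) (auto simp: \<Phi>' zero_prod_def)
    then show ?thesis using linear_injective_0[OF linear_blinfun_apply] by blast
  qed
  then have "C1_on \<Psi> UNIV"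
  proof (rule C1_on_inverse[OF der cont])
    show "\<Psi> (\<Phi> z) = z" for z
      by (cases z) (simp add: \<Phi>_def \<Psi>_def momentum_inverse_left[OF assms])
    show "\<Phi> (\<Psi> z) = z" for z
      using inv by (cases z) (simp add: \<Phi>_def \<Psi>_def momentum_inverse_def)
  qed
  then have "C1_on (\<lambda>z. snd (snd (\<Psi> z))) UNIV"
    by (intro C1_on_compose[OF C1_on_compose[OF _ C1_on_snd subset_UNIV] C1_on_snd subset_UNIV])
  then show ?thesis by (simp add: C1_constitutive_def \<Psi>_def case_prod_unfold)
qed

lemma C1_stress_tilde:
  assumes "C1_constitutive Sh" and "C1_constitutive ph"
  shows "C1_constitutive (stress_tilde Sh ph)"
proof -
  have "C1_on (\<lambda>z. (fst z, fst (snd z), (\<lambda>(x, F, p). ph x F p) z)) UNIV"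
    using assms(2) unfolding C1_constitutive_def
    by (intro C1_on_Pair C1_on_fst C1_on_compose[OF C1_on_snd C1_on_fst subset_UNIV])
  from C1_on_compose[OF this assms(1)[unfolded C1_constitutive_def] subset_UNIV] show ?thesis
    by (simp add: C1_constitutive_def stress_tilde_def case_prod_unfold)
qed

subsection \<open>The dissipation inequality and the energy relations\<close>

text \<open>Inserting \<open>ph\<close> into \<open>vh\<close> returns \<open>v\<close>, and
  inserting it into \<open>Sh\<close> gives the reduced stress, so the laws for the pair
  \<open>F\<close>, \<open>v\<close> are exactly those for \<open>F\<close> and the
  momentum.\<close>

lemma classical_solution_admissible:
  assumes inv: "momentum_inverse vh ph" and ph: "C1_constitutive ph"
    and sol: "classical_solution ph (stress_tilde Sh ph) T F0 v0 F v"
  shows "admissible_process vh Sh T F (\<lambda>x t. ph x (F x t) (v x t))"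
proof -
  have "UNIV \<times> {0<..<T} \<subseteq> (UNIV :: vec3 set) \<times> {0..<T}" by auto
  then have "C1_on (\<lambda>(x, t). F x t) (UNIV \<times> {0<..<T})" "C1_on (\<lambda>(x, t). v x t) (UNIV \<times> {0<..<T})"
    using sol C1_on_subset unfolding classical_solution_def by blast+
  with C1_on_constitutive_compose[OF ph this] show ?thesis
    using sol inv
    unfolding admissible_process_def classical_solution_def stress_tilde_def momentum_inverse_def
    by simp
qed

text \<open>The amplitude \<open>b\<close> enters the divergence at \<open>x\<close> only through the ellipticity matrix,
  the velocity gradient \<open>B\<close> only through the first summand.\<close>
lemma Div_initial_stress:
  assumes D: "((\<lambda>(x, F, v). St x F v) has_derivative D) (at (x, A, c))"
  shows "Div (\<lambda>y. St y (A + (a \<bullet> (y - x)) *\<^sub>R tensor_prod b a) (B *v (y - x) + c)) x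
    = (\<chi> i. \<Sum>j\<in>UNIV. D (axis j 1, 0, B *v axis j 1) $ i $ j) + ellipticity_matrix St x A c a *v b"
proof -
  have lin: "linear D" using D has_derivative_linear by blast
  have "((\<lambda>y. (y, A + (a \<bullet> (y - x)) *\<^sub>R tensor_prod b a, B *v (y - x) + c)) has_derivative
    (\<lambda>h. (h, (a \<bullet> h) *\<^sub>R tensor_prod b a, B *v h))) (at x)"
    by (auto intro!: derivative_eq_intros bounded_linear.has_derivative[OF matrix_vector_mul_bounded_linear])
  from has_derivative_compose[OF this, of "\<lambda>(x, F, v). St x F v" D] D
  have "((\<lambda>y. St y (A + (a \<bullet> (y - x)) *\<^sub>R tensor_prod b a) (B *v (y - x) + c)) has_derivative
    (\<lambda>h. D (h, (a \<bullet> h) *\<^sub>R tensor_prod b a, B *v h))) (at x)"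
    by simp
  note Div_eq[OF this]
  moreover have "D (axis j 1, (a \<bullet> axis j 1) *\<^sub>R tensor_prod b a, B *v axis j 1) $ i $ j =
    D (axis j 1, 0, B *v axis j 1) $ i $ j
      + (\<Sum>h\<in>UNIV. \<Sum>k\<in>UNIV. pd_tensor h k (\<lambda>G. St x G c $ i $ j) A * a $ j * a $ k * b $ h)" for i j
  proof -
    have pT: "((\<lambda>G. St x G c $ i $ j) has_derivative (\<lambda>G. D (0, G, 0) $ i $ j)) (at A)"
      by (intro has_derivative_vec_nth constitutive_partial_tensor[OF D])
    \<comment> \<open>Moving in direction \<open>j\<close> changes the deformation gradient by
      \<open>a $ j\<close> times \<open>tensor_prod b a\<close>. Linearity detaches this
      contribution from those of the point and the velocity.\<close>
    have "D (axis j 1, (a \<bullet> axis j 1) *\<^sub>R tensor_prod b a, B *v axis j 1)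
      = D (axis j 1, 0, B *v axis j 1) + a $ j *\<^sub>R D (0, tensor_prod b a, 0)"
      using linear_add[OF lin, of "(axis j 1, 0, B *v axis j 1)" "(0, (a \<bullet> axis j 1) *\<^sub>R tensor_prod b a, 0)"]
        linear_scale[OF lin, of "a $ j" "(0, tensor_prod b a, 0)"]
      by (simp add: inner_axis)
    moreover have "D (0, tensor_prod b a, 0) $ i $ j
      = (\<Sum>h\<in>UNIV. \<Sum>k\<in>UNIV. b $ h * a $ k * pd_tensor h k (\<lambda>G. St x G c $ i $ j) A)"
      by (subst linear_tensor_expand[OF has_derivative_linear[OF pT]])
        (simp add: tensor_prod_def pd_tensor_eq[OF pT])
    ultimately show ?thesis
      by (simp add: sum_distrib_left algebra_simps)
  qed
  \<comment> \<open>Moving the sum over \<open>h\<close> outermost collects the coefficients of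
    \<open>b $ h\<close> into the entries of the ellipticity matrix.\<close>
  moreover have "(\<Sum>j\<in>UNIV. \<Sum>h\<in>UNIV. \<Sum>k\<in>UNIV. pd_tensor h k (\<lambda>G. St x G c $ i $ j) A * a $ j * a $ k * b $ h)
    = (ellipticity_matrix St x A c a *v b) $ i" for i
    unfolding matrix_vector_mult_def ellipticity_matrix_def
    by (subst sum.swap) (simp add: sum_distrib_right)
  ultimately show ?thesis
    by (simp add: vec_eq_iff sum.distrib)
qed

text \<open>Continuity up to the initial time turns the dissipation inequality on \<open>(0, T)\<close> into an
  inequality for the initial data.\<close>
lemma dissipation_initial:
  assumes Sh: "C1_constitutive Sh" and vh: "C1_constitutive vh" and ph: "C1_constitutive ph"
    and tauh: "C1_constitutive tauh" and inv: "momentum_inverse vh ph" and "0 < T"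
    and sol: "classical_solution ph (stress_tilde Sh ph) T F0 v0 F v"
    and diss: "dissipation_inequality vh Sh tauh T F (\<lambda>x t. ph x (F x t) (v x t))"
    and p: "p = ph x (F0 x) (v0 x)"
  shows "(grad_deformation tauh x (F0 x) p - Sh x (F0 x) p) \<bullet> Grad v0 x
    + (grad_momentum tauh x (F0 x) p - vh x (F0 x) p) \<bullet> Div (\<lambda>y. stress_tilde Sh ph y (F0 y) (v0 y)) x \<le> 0"
proof -
  let ?I = "{0..<T}"
  let ?St = "stress_tilde Sh ph"
  define P where "P x t = ph x (F x t) (v x t)" for x t
  define G where "G t = Grad (\<lambda>y. v y t) x" for t
  define R where "R t = Div (\<lambda>y. ?St y (F y t) (v y t)) x" for t
  obtain D where D: "\<And>z. ((\<lambda>(x, F, p). tauh x F p) has_derivative blinfun_apply (D z)) (at z)"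
    and contD: "continuous_on UNIV D"
    using tauh by (rule C1_constitutiveE) (rule that; assumption)
  have F: "C1_on (\<lambda>(x, t). F x t) (UNIV \<times> ?I)" and v: "C1_on (\<lambda>(x, t). v x t) (UNIV \<times> ?I)"
    and init: "\<And>y. F y 0 = F0 y" "\<And>y. v y 0 = v0 y"
    using sol unfolding classical_solution_def by auto
  have P: "C1_on (\<lambda>(x, t). P x t) (UNIV \<times> ?I)"
    unfolding P_def by (rule C1_on_constitutive_compose[OF ph F v])
  have slice: "continuous_on ?I (g x)" if "C1_on (\<lambda>(x, t). g x t) (UNIV \<times> ?I)"
    for g :: "vec3 \<Rightarrow> real \<Rightarrow> 'c::real_normed_vector"
  proof -
    have "continuous_on (UNIV \<times> ?I) (\<lambda>(x, t). g x t)"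
      using that has_derivative_continuous unfolding C1_on_def continuous_on_eq_continuous_within by blast
    moreover have "continuous_on ?I (\<lambda>t. (x, t))" by (intro continuous_intros)
    moreover have "(\<lambda>t. (x, t)) ` ?I \<subseteq> UNIV \<times> ?I" by auto
    ultimately have "continuous_on ?I (\<lambda>t. (\<lambda>(x, t). g x t) (x, t))" by (rule continuous_on_compose2)
    then show ?thesis by simp
  qed
  \<comment> \<open>Energy rate minus power, with the time derivatives replaced through the
    conservation laws by the spatial fields \<open>G\<close> and \<open>R\<close>. Unlike two-sided
    time derivatives, these make sense and are continuous at \<open>t = 0\<close>.\<close>
  define Q where "Q t = D (x, F x t, P x t) (0, G t, R t)
    - (Sh x (F x t) (P x t) \<bullet> G t + vh x (F x t) (P x t) \<bullet> R t)" for t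
  have "continuous_on ?I (\<lambda>t. D (x, F x t, P x t))"
    by (intro continuous_on_compose2[OF contD _ subset_UNIV] continuous_on_Pair continuous_on_const
        slice[OF F] slice[OF P])
  moreover have "continuous_on ?I (\<lambda>t. Sh x (F x t) (P x t))" "continuous_on ?I (\<lambda>t. vh x (F x t) (P x t))"
    using slice[OF C1_on_constitutive_compose[OF Sh F P]] slice[OF C1_on_constitutive_compose[OF vh F P]] by auto
  moreover have "continuous_on ?I G" "continuous_on ?I R"
    unfolding G_def R_def
    by (intro continuous_on_Grad[OF v] continuous_on_Div
        C1_on_constitutive_compose[OF C1_stress_tilde[OF Sh ph] F v])+
  ultimately have "continuous_on ?I Q"
    unfolding Q_def by (intro continuous_intros)
  then have "(Q \<longlongrightarrow> Q 0) (at 0 within {0..<T})"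
    using \<open>0 < T\<close> by (simp add: continuous_on_def)
  then have "(Q \<longlongrightarrow> Q 0) (at 0 within {0<..<T})"
    by (rule tendsto_within_subset) auto
  moreover have "Q t \<le> 0" if t: "t \<in> {0<..<T}" for t
  proof -
    have adm: "admissible_process vh Sh T F P"
      unfolding P_def by (rule classical_solution_admissible[OF inv ph sol])
    have "time_deriv F x t = G t" and "time_deriv P x t = R t"
      using sol t unfolding classical_solution_def G_def R_def P_def by auto
    moreover have "time_deriv (\<lambda>y s. tauh y (F y s) (P y s)) x t
        \<le> Sh x (F x t) (P x t) \<bullet> time_deriv F x t + vh x (F x t) (P x t) \<bullet> time_deriv P x t"
      using diss t unfolding dissipation_inequality_def P_def by blast
    moreover have "time_deriv (\<lambda>y s. tauh y (F y s) (P y s)) x t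
        = D (x, F x t, P x t) (0, time_deriv F x t, time_deriv P x t)"
      using adm unfolding admissible_process_def by (intro time_deriv_energy[OF _ _ t D]) auto
    ultimately show ?thesis by (simp add: Q_def)
  qed
  then have "\<forall>\<^sub>F t in at 0 within {0<..<T}. Q t \<le> 0"
    by (simp add: eventually_at_filter)
  \<comment> \<open>0 is a limit point of the open interval, so the bound on \<open>Q\<close>
    survives the passage to the limit.\<close>
  moreover have "at 0 within {0<..<T} \<noteq> bot"
    using \<open>0 < T\<close> by (simp add: trivial_limit_within islimpt_greaterThanLessThan1)
  ultimately have "Q 0 \<le> 0"
    by (intro tendsto_upperbound[of Q])
  moreover have "P x 0 = p" by (simp add: P_def p init)
  ultimately show ?thesis
    by (simp add: Q_def G_def R_def init energy_differential[OF D] inner_diff_left)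
qed

lemma dissipation_imp_energy_relations:
  assumes vh: "C1_constitutive vh" and Sh: "C1_constitutive Sh" and tauh: "C1_constitutive tauh"
    and N: "normal_velocity vh" and inv: "momentum_inverse vh ph"
    and ell: "elliptic (stress_tilde Sh ph)"
    and "0 < T" and solv: "solvable ph (stress_tilde Sh ph) T"
    and diss: "\<And>F p. admissible_process vh Sh T F p \<Longrightarrow> dissipation_inequality vh Sh tauh T F p"
  shows "energy_relations vh Sh tauh"
  unfolding energy_relations_def
proof (intro allI)
  fix x A p
  let ?St = "stress_tilde Sh ph"
  \<comment> \<open>This initial velocity at \<open>x\<close> makes the initial momentum there equal
    to the prescribed \<open>p\<close>.\<close>
  define c where "c = vh x A p"
  define a :: vec3 where "a = axis 1 1"
  define \<sigma> where "\<sigma> = grad_deformation tauh x A p - Sh x A p"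
  define \<nu> where "\<nu> = grad_momentum tauh x A p - vh x A p"
  have ph: "C1_constitutive ph" by (rule C1_momentum_inverse[OF vh N inv])
  have p: "p = ph x A c" unfolding c_def by (rule momentum_inverse_left[OF vh N inv, symmetric])
  have "a \<noteq> 0" by (simp add: a_def axis_eq_0_iff)
  obtain D where D: "((\<lambda>(x, F, v). ?St x F v) has_derivative D) (at (x, A, c))"
    using C1_stress_tilde[OF Sh ph] by (rule C1_constitutiveE) (rule that; assumption)
  \<comment> \<open>The part of the initial stress divergence that does not involve
    \<open>b\<close>. At \<open>B = 0\<close> it need not vanish, as it retains the explicit
    dependence of the stress on the point.\<close>
  define d where "d B = (\<chi> i. \<Sum>j\<in>UNIV. D (axis j 1, 0, B *v axis j 1) $ i $ j)" for B :: tensor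
  define E where "E = ellipticity_matrix ?St x A c a"
  have key: "\<sigma> \<bullet> B + \<nu> \<bullet> (d B + E *v b) \<le> 0" for B b
  proof -
    let ?F0 = "\<lambda>y. A + (a \<bullet> (y - x)) *\<^sub>R tensor_prod b a"
    let ?v0 = "\<lambda>y. B *v (y - x) + c"
    obtain F v where sol: "classical_solution ph ?St T ?F0 ?v0 F v"
      using solv \<open>a \<noteq> 0\<close> unfolding solvable_def by blast
    have "(?v0 has_derivative (\<lambda>h. B *v h)) (at x)"
      by (auto intro!: derivative_eq_intros bounded_linear.has_derivative[OF matrix_vector_mul_bounded_linear])
    then have "Grad ?v0 x = B"
      by (simp add: Grad_eq vec_eq_iff matrix_vector_mul_component inner_axis)
    then show ?thesis
      using dissipation_initial[OF Sh vh ph tauh inv \<open>0 < T\<close> sol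
          diss[OF classical_solution_admissible[OF inv ph sol]], of p x] p
      by (simp add: Div_initial_stress[OF D] \<sigma>_def \<nu>_def d_def E_def)
  qed
  obtain E' where "E ** E' = mat 1"
    using ell \<open>a \<noteq> 0\<close> unfolding elliptic_def invertible_def E_def by blast
  \<comment> \<open>With \<open>b = E' *v (\<nu> - d 0)\<close> and \<open>B = 0\<close> the bracket
    in \<open>key\<close> becomes \<open>\<nu>\<close> itself.\<close>
  then have "E *v (E' *v (\<nu> - d 0)) = \<nu> - d 0"
    by (simp add: matrix_vector_mul_assoc)
  with key[of 0 "E' *v (\<nu> - d 0)"] have "\<nu> \<bullet> \<nu> \<le> 0" by simp
  then have \<nu>: "\<nu> = 0" by (metis inner_eq_zero_iff inner_ge_zero order_antisym)
  \<comment> \<open>Once \<open>\<nu>\<close> vanishes, the term with \<open>d B\<close> disappears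
    and \<open>B\<close> is free to be \<open>\<sigma>\<close>.\<close>
  with key[of \<sigma> 0] have "\<sigma> \<bullet> \<sigma> \<le> 0" by simp
  then have "\<sigma> = 0" by (metis inner_eq_zero_iff inner_ge_zero order_antisym)
  with \<nu> show "vh x A p = grad_momentum tauh x A p \<and> Sh x A p = grad_deformation tauh x A p"
    by (simp add: \<sigma>_def \<nu>_def)
qed

lemma energy_relations_imp_dissipation:
  assumes tauh: "C1_constitutive tauh" and rel: "energy_relations vh Sh tauh"
    and adm: "admissible_process vh Sh T F p"
  shows "dissipation_inequality vh Sh tauh T F p"
proof -
  obtain D where D: "\<And>z. ((\<lambda>(x, F, p). tauh x F p) has_derivative blinfun_apply (D z)) (at z)"
    using tauh by (rule C1_constitutiveE) (rule that; assumption)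
  have "time_deriv (\<lambda>y s. tauh y (F y s) (p y s)) x t
      = Sh x (F x t) (p x t) \<bullet> time_deriv F x t + vh x (F x t) (p x t) \<bullet> time_deriv p x t"
    if t: "t \<in> {0<..<T}" for x t
  proof -
    have "time_deriv (\<lambda>y s. tauh y (F y s) (p y s)) x t
        = D (x, F x t, p x t) (0, time_deriv F x t, time_deriv p x t)"
      using adm unfolding admissible_process_def by (intro time_deriv_energy[OF _ _ t D]) auto
    then show ?thesis
      using rel by (simp add: energy_differential[OF D] energy_relations_def)
  qed
  then show ?thesis unfolding dissipation_inequality_def by simp
qed

text \<open>By the energy relations, \<open>Sh $ i $ j\<close> and \<open>vh $ k\<close> are the
  differential \<open>D\<close> of the energy evaluated in the constant directions \<open>?u\<close>
  and \<open>?w\<close>. Differentiating each in the other direction gives the two mixed second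
  derivatives.\<close>

lemma energy_relations_reciprocity:
  assumes rel: "energy_relations vh Sh tauh" and "C2_constitutive tauh"
  shows "pd_vec k (\<lambda>q. Sh x F q $ i $ j) p = pd_tensor i j (\<lambda>G. vh x G p $ k) F"
proof -
  obtain D where D: "\<And>z. ((\<lambda>(x, F, p). tauh x F p) has_derivative blinfun_apply (D z)) (at z)"
    and "C1_on D UNIV"
    using assms(2) unfolding C2_constitutive_def C2_on_def by auto
  then obtain D2 where D2: "\<And>z. (D has_derivative blinfun_apply (D2 z)) (at z)"
    and cont: "continuous_on UNIV D2"
    unfolding C1_on_def by auto
  let ?u = "(0, axis i (axis j 1), 0) :: vec3 \<times> tensor \<times> vec3"
  let ?w = "(0, 0, axis k 1) :: vec3 \<times> tensor \<times> vec3"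
  have S: "Sh x F q $ i $ j = D (x, F, q) ?u" for q
    using rel pd_tensor_eq[OF constitutive_partial_tensor[OF D]]
    by (simp add: energy_relations_def grad_deformation_def)
  have V: "vh x G p $ k = D (x, G, p) ?w" for G
    using rel pd_vec_eq[OF constitutive_partial_vec[OF D]]
    by (simp add: energy_relations_def grad_momentum_def)
  have "((\<lambda>q. (x, F, q)) has_derivative (\<lambda>q. (0, 0, q))) (at p)"
    by (auto intro!: derivative_eq_intros)
  \<comment> \<open>Evaluation of \<open>D\<close> at the fixed direction \<open>?u\<close> is
    bounded linear, so it commutes with differentiation along the momentum slot.\<close>
  from bounded_linear.has_derivative[OF blinfun.bounded_linear_left[of ?u] has_derivative_compose[OF this D2]]
  have "pd_vec k (\<lambda>q. Sh x F q $ i $ j) p = D2 (x, F, p) ?w ?u"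
    unfolding S by (rule pd_vec_eq)
  moreover have "((\<lambda>G. (x, G, p)) has_derivative (\<lambda>G. (0, G, 0))) (at F)"
    by (auto intro!: derivative_eq_intros)
  from bounded_linear.has_derivative[OF blinfun.bounded_linear_left[of ?w] has_derivative_compose[OF this D2]]
  have "pd_tensor i j (\<lambda>G. vh x G p $ k) F = D2 (x, F, p) ?u ?w"
    unfolding V by (rule pd_tensor_eq)
  ultimately show ?thesis using second_derivative_symmetric[OF D D2 cont] by metis
qed

theorem proposition2:
  fixes vh :: "vec3 constitutive" and Sh :: "tensor constitutive" and tauh :: "real constitutive"
    and ph :: "vec3 constitutive" and T :: real
  assumes "C1_constitutive vh" and "C1_constitutive Sh" and "C1_constitutive tauh"
    and "normal_velocity vh"
    and "momentum_inverse vh ph"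
    and "elliptic (stress_tilde Sh ph)"
    and "0 < T" and "solvable ph (stress_tilde Sh ph) T"
  shows "((\<forall>F p. admissible_process vh Sh T F p \<longrightarrow> dissipation_inequality vh Sh tauh T F p)
            \<longleftrightarrow> energy_relations vh Sh tauh) \<and>
         (energy_relations vh Sh tauh \<and> C2_constitutive tauh \<longrightarrow>
            (\<forall>x F p i j k. pd_vec k (\<lambda>q. Sh x F q $ i $ j) p = pd_tensor i j (\<lambda>G. vh x G p $ k) F))"
  using dissipation_imp_energy_relations[OF assms] energy_relations_imp_dissipation[OF assms(3)]
    energy_relations_reciprocity
  by blast

end
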